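(* For every $n\ge 1$, there is an exact affine OBDD on the $2n$ variables $x_1,\dots,x_n,y_1,\dots,y_n$ with the identity order (reading $x_1,\dots,x_n,y_1,\dots,y_n$), having $p(n)^2$ classical states and $n+1$ affine states, that computes the mixed weighted sum function $\mathtt{MWS}_n$.
   Context: $p(n)$ is the smallest prime greater than $n$; for $z\in\{0,1\}^n$, $s_n(z)=\left(\sum_{i=1}^n i\cdot z_i\right)\bmod p(n)$. $\mathtt{MWS}_n:\{0,1\}^n\times\{0,1\}^n\to\{0,1\}$ is defined by $\mathtt{MWS}_n(x,y)=x_i\oplus y_i$ if $i=s_n(x)=s_n(y)\in\{1,\dots,n\}$, and $0$ otherwise. An affine OBDD (AfOBDD) is a tuple $(S,E,\delta,T,s_I,v_0,S_a,E_a,\pi)$: $S$ is a finite set of classical states with initial state $s_I$ and accepting set $S_a$; $E=\{e_1,\dots,e_{m_2}\}$ is a set of affine states with accepting set $E_a$; $v_0\in\mathbb{R}^{m_2}$ is an initial affine state (entries sum to $1$); $\pi$ is a permutation of the variable indices; for each step $i$, $\delta_i:S\times\{0,1\}\to S$; and for each step $i$, classical state $s$ and bit $b$, $T_i^{s,b}$ is a real $m_2\times m_2$ matrix each of whose columns sums to $1$. On an input it starts in $(s_I,v_0)$; at step $j$, from $(s,v_{j-1})$ it sets $v_j=T_j^{s,b}v_{j-1}$ where $b$ is the bit read at step $j$, and then sets the classical state to $\delta_j(s,b)$. If the final classical state is not in $S_a$ it rejects; otherwise it accepts with probability $\sum_{e_i\in E_a}|v_f[i]|/\|v_f\|_1$.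 It computes $f$ exactly if $1$-inputs are accepted with probability $1$ and $0$-inputs with probability $0$. *)

theory Defs
  imports
    Complex_Main
    "HOL-Computational_Algebra.Primes"
    "HOL-Combinatorics.Permutations"
    "Jordan_Normal_Form.Matrix"
begin

definition next_prime :: "nat \<Rightarrow> nat" where
  "next_prime n = (LEAST p. prime p \<and> p > n)"

text \<open>
  Elements of $\{0,1\}^n$ are Boolean lists of length n. The mathematical coordinate
  z_i (with i between 1 and n) is the list entry at position i - 1.
\<close>

definition weighted_sum :: "nat \<Rightarrow> bool list \<Rightarrow> nat" where
  "weighted_sum n z = (\<Sum>i=1..n. i * of_bool (z ! (i - 1))) mod next_prime n"

definition MWS :: "nat \<Rightarrow> bool list \<Rightarrow> bool list \<Rightarrow> bool" where
  "MWS n x y =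
     (let i = weighted_sum n x
      in if i = weighted_sum n y \<and> i \<in> {1..n} then x ! (i - 1) \<noteq> y ! (i - 1) else False)"

text \<open>
  Affine OBDDs. The affine states e_1, ..., e_m are represented by the indices 0, ..., m - 1,
  where m is the field \<open>num_affine\<close>. Steps and variables are likewise numbered from 0:
  at step j the automaton reads the input variable with index \<open>var_order M j\<close>.
\<close>

record 's afobdd =
  states :: "'s set"
  num_affine :: nat
  delta :: "nat \<Rightarrow> 's \<Rightarrow> bool \<Rightarrow> 's"
  trans_mat :: "nat \<Rightarrow> 's \<Rightarrow> bool \<Rightarrow> real mat"
  init_state :: 's
  init_vec :: "real vec"
  acc_states :: "'s set"
  acc_affine :: "nat set"
  var_order :: "nat \<Rightarrow> nat"

definition affine_vec :: "nat \<Rightarrow> real vec \<Rightarrow> bool" where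
  "affine_vec m v \<longleftrightarrow> v \<in> carrier_vec m \<and> (\<Sum>i<m. v $ i) = 1"

definition affine_mat :: "nat \<Rightarrow> real mat \<Rightarrow> bool" where
  "affine_mat m A \<longleftrightarrow> A \<in> carrier_mat m m \<and> (\<forall>k<m. (\<Sum>i<m. A $$ (i, k)) = 1)"

definition is_afobdd :: "nat \<Rightarrow> 's afobdd \<Rightarrow> bool" where
  "is_afobdd N M \<longleftrightarrow>
     finite (states M) \<and>
     init_state M \<in> states M \<and>
     acc_states M \<subseteq> states M \<and>
     acc_affine M \<subseteq> {..<num_affine M} \<and>
     affine_vec (num_affine M) (init_vec M) \<and>
     var_order M permutes {..<N} \<and>
     (\<forall>j<N. \<forall>s\<in>states M. \<forall>b.
        delta M j s b \<in> states M \<and> affine_mat (num_affine M) (trans_mat M j s b))"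

fun config :: "'s afobdd \<Rightarrow> bool list \<Rightarrow> nat \<Rightarrow> 's \<times> real vec" where
  "config M w 0 = (init_state M, init_vec M)"
| "config M w (Suc j) =
     (let (s, v) = config M w j; b = w ! var_order M j
      in (delta M j s b, trans_mat M j s b *\<^sub>v v))"

definition accept_prob :: "nat \<Rightarrow> 's afobdd \<Rightarrow> bool list \<Rightarrow> real" where
  "accept_prob N M w =
     (let (s, v) = config M w N
      in if s \<in> acc_states M
         then (\<Sum>i\<in>acc_affine M. \<bar>v $ i\<bar>) / (\<Sum>i<num_affine M. \<bar>v $ i\<bar>)
         else 0)"

definition computes_exactly :: "nat \<Rightarrow> 's afobdd \<Rightarrow> (bool list \<Rightarrow> bool) \<Rightarrow> bool" where
  "computes_exactly N M f \<longleftrightarrow>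
     (\<forall>w. length w = N \<longrightarrow>
        (f w \<longrightarrow> accept_prob N M w = 1) \<and> (\<not> f w \<longrightarrow> accept_prob N M w = 0))"

end

theory Submission
  imports Defs
begin

text \<open>
  The classical states hold the two weighted sums read so far. The first n affine coordinates
  start at 0, and reading a 1 at \<open>x\<^sub>i\<close> or \<open>y\<^sub>i\<close> replaces coordinate i by 1 minus itself. This is
  linear, because the entries of an affine state sum to 1; the last coordinate absorbs the
  difference. After both passes coordinate i is \<open>x\<^sub>i \<oplus> y\<^sub>i\<close>. The matrix of the last step depends on
  the classical state and the last bit, hence on the final weighted sums, so it can flip and at the
  same time move the selected coordinate to the accepting state and everything else to the last one.
\<close>

section \<open>Bound on the modulus, affine matrices and coordinate flips\<close>

lemma next_prime_greater: "n < next_prime n"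
proof -
  obtain p where "prime p \<and> p > n"
    using bigger_prime by blast
  then show ?thesis
    unfolding next_prime_def by (rule LeastI2) simp
qed

text \<open>Coefficients for the first n rows can be chosen freely, since the last row is then
  forced by the column sums. Later arguments therefore track only coordinates below n.\<close>

definition affine_completion :: "nat \<Rightarrow> (nat \<Rightarrow> nat \<Rightarrow> real) \<Rightarrow> real mat" where
  "affine_completion n R =
     mat (n + 1) (n + 1) (\<lambda>(i, k). if i < n then R i k else 1 - (\<Sum>l<n. R l k))"

lemma affine_mat_affine_completion: "affine_mat (n + 1) (affine_completion n R)"
  unfolding affine_mat_def affine_completion_def by simp

lemma affine_completion_mult_index:
  assumes "v \<in> carrier_vec (n + 1)" "i < n"
  shows "(affine_completion n R *\<^sub>v v) $ i = (\<Sum>k<n + 1. R i k * v $ k)"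
  using assms unfolding affine_completion_def
  by (simp add: scalar_prod_def lessThan_atLeast0)

text \<open>Column sums 1 mean that the all-ones row vector is a left fixed vector of
  \<open>A\<close>; exchanging the two sums turns this into preservation of the coordinate
  sum.\<close>

lemma affine_vec_mult_mat:
  assumes "affine_mat m A" "affine_vec m v"
  shows "affine_vec m (A *\<^sub>v v)"
proof -
  have A: "A \<in> carrier_mat m m" and cols: "\<And>k. k < m \<Longrightarrow> (\<Sum>i<m. A $$ (i, k)) = 1"
    and v: "v \<in> carrier_vec m" and sum: "(\<Sum>i<m. v $ i) = 1"
    using assms by (auto simp: affine_mat_def affine_vec_def)
  have "(\<Sum>i<m. (A *\<^sub>v v) $ i) = (\<Sum>i<m. \<Sum>k<m. A $$ (i, k) * v $ k)"
    using A v by (intro sum.cong) (auto simp: scalar_prod_def lessThan_atLeast0)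
  also have "\<dots> = (\<Sum>k<m. \<Sum>i<m. A $$ (i, k) * v $ k)"
    by (rule sum.swap)
  also have "\<dots> = (\<Sum>k<m. v $ k)"
    by (intro sum.cong) (simp_all add: sum_distrib_right [symmetric] cols)
  finally show ?thesis
    using A v sum by (simp add: affine_vec_def)
qed

text \<open>On an affine vector, \<open>1 - v $ i\<close> is the sum of all entries minus
  \<open>v $ i\<close>; this gives the flipped row 0 at \<open>k = i\<close> and 1
  elsewhere.\<close>

definition flip_coeff :: "nat \<Rightarrow> bool \<Rightarrow> nat \<Rightarrow> nat \<Rightarrow> real" where
  "flip_coeff l b i k = (if b \<and> i = l then 1 - of_bool (k = i) else of_bool (k = i))"

lemma sum_flip_coeff:
  assumes "affine_vec (n + 1) v" "i < n"
  shows "(\<Sum>k<n + 1. flip_coeff l b i k * v $ k) = (if b \<and> i = l then 1 - v $ i else v $ i)"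
proof -
  have sum: "(\<Sum>k<n + 1. v $ k) = 1"
    using assms by (simp add: affine_vec_def)
  have pick: "(\<Sum>k<n + 1. of_bool (k = i) * v $ k) = v $ i"
    using assms by (simp add: of_bool_def if_distrib [of "\<lambda>c. c * _"] cong: if_cong)
  show ?thesis
  proof (cases "b \<and> i = l")
    case True
    then show ?thesis
      using sum pick unfolding flip_coeff_def
      by (simp add: left_diff_distrib sum_subtractf del: sum.lessThan_Suc)
  next
    case False
    then have "flip_coeff l b i k = of_bool (k = i)" for k
      by (auto simp: flip_coeff_def)
    then show ?thesis
      using False pick by auto
  qed
qed

section \<open>The automaton and its well-formedness\<close>

text \<open>The state \<open>a + p * b\<close> encodes the pair (a, b) of weighted sums modulo p.\<close>

definition mws_delta :: "nat \<Rightarrow> nat \<Rightarrow> nat \<Rightarrow> bool \<Rightarrow> nat" where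
  "mws_delta n j s b =
     (let p = next_prime n
      in if j < n then (s mod p + Suc j * of_bool b) mod p + p * (s div p)
         else s mod p + p * ((s div p + Suc (j - n) * of_bool b) mod p))"

definition selects :: "nat \<Rightarrow> nat \<Rightarrow> bool" where
  "selects n s \<longleftrightarrow>
     s mod next_prime n = s div next_prime n \<and> s mod next_prime n \<in> {1..n}"

text \<open>The last step inspects the successor state, because the final weighted sums include the
  bit just read. Row 0 then takes the flipped row of the selected coordinate; the shift by 1 passes
  from variable indices 1..n to coordinates 0..n-1.\<close>

definition mws_coeff :: "nat \<Rightarrow> nat \<Rightarrow> nat \<Rightarrow> bool \<Rightarrow> nat \<Rightarrow> nat \<Rightarrow> real" where
  "mws_coeff n j s b i k =
     (if Suc j < 2 * n then flip_coeff (if j < n then j else j - n) b i k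
      else let s' = mws_delta n j s b
           in if i = 0 \<and> selects n s' then flip_coeff (j - n) b (s' mod next_prime n - 1) k else 0)"

text \<open>All classical states accept, so the decision rests with the affine part. The last unit
  vector makes coordinates below n start at 0.\<close>

definition mws_afobdd :: "nat \<Rightarrow> nat afobdd" where
  "mws_afobdd n =
     \<lparr>states = {..<(next_prime n)\<^sup>2}, num_affine = n + 1,
      delta = mws_delta n,
      trans_mat = (\<lambda>j s b. affine_completion n (mws_coeff n j s b)),
      init_state = 0, init_vec = unit_vec (n + 1) n,
      acc_states = {..<(next_prime n)\<^sup>2}, acc_affine = {0}, var_order = id\<rparr>"

lemma pair_encoding_less:
  fixes a b p :: nat
  assumes "a < p" "b < p"
  shows "a + p * b < p\<^sup>2"
proof -
  have "a + p * b < p * Suc b"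
    using assms by simp
  also have "\<dots> \<le> p * p"
    using assms by (intro mult_le_mono2) simp
  finally show ?thesis
    by (simp add: power2_eq_square)
qed

lemma mws_delta_less:
  assumes "s < (next_prime n)\<^sup>2"
  shows "mws_delta n j s b < (next_prime n)\<^sup>2"
proof -
  have "0 < next_prime n"
    using next_prime_greater [of n] by simp
  \<comment> \<open>The first pass leaves the quotient unchanged, so its bound has to come from the
    old state.\<close>
  moreover have "s div next_prime n < next_prime n"
    using assms by (simp add: power2_eq_square less_mult_imp_div_less)
  ultimately show ?thesis
    using assms unfolding mws_delta_def Let_def by (auto intro!: pair_encoding_less)
qed

lemma is_afobdd_mws: "n \<ge> 1 \<Longrightarrow> is_afobdd (2 * n) (mws_afobdd n)"
  using next_prime_greater [of n] affine_mat_affine_completion [of n]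
  by (auto simp: is_afobdd_def mws_afobdd_def affine_vec_def mws_delta_less permutes_id
      unit_vec_def)

section \<open>The classical run\<close>

lemma fst_config_mws_Suc:
  "fst (config (mws_afobdd n) w (Suc j)) =
     mws_delta n j (fst (config (mws_afobdd n) w j)) (w ! j)"
  by (simp add: mws_afobdd_def case_prod_beta Let_def)

text \<open>One formula covers both passes: truncated subtraction keeps the second sum empty up to
  step n, and \<open>min j n\<close> freezes the first sum afterwards.\<close>

lemma fst_config_mws:
  "fst (config (mws_afobdd n) w j) =
     (\<Sum>i<min j n. Suc i * of_bool (w ! i)) mod next_prime n +
     next_prime n * ((\<Sum>i<j - n. Suc i * of_bool (w ! (n + i))) mod next_prime n)"
proof (induction j)
  case 0
  then show ?case by (simp add: mws_afobdd_def)
next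
  case (Suc j)
  define p where "p = next_prime n"
  have p: "p > 0"
    using next_prime_greater [of n] by (simp add: p_def)
  show ?case
  proof (cases "j < n")
    case True
    then have "min j n = j" "min (Suc j) n = Suc j" "j - n = 0" "Suc j - n = 0"
      by auto
    then show ?thesis
      using p True unfolding fst_config_mws_Suc Suc.IH mws_delta_def Let_def p_def [symmetric]
      by (simp add: mod_simps)
  next
    case False
    then have "min j n = n" "min (Suc j) n = n" "Suc j - n = Suc (j - n)" "n + (j - n) = j"
      by auto
    then show ?thesis
      using p False unfolding fst_config_mws_Suc Suc.IH mws_delta_def Let_def p_def [symmetric]
      by (simp add: mod_simps)
  qed
qed

section \<open>The affine run\<close>

lemma snd_config_mws_Suc:
  "snd (config (mws_afobdd n) w (Suc j)) =
     affine_completion n (mws_coeff n j (fst (config (mws_afobdd n) w j)) (w ! j))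
       *\<^sub>v snd (config (mws_afobdd n) w j)"
  by (simp add: mws_afobdd_def case_prod_beta Let_def)

lemma affine_vec_config_mws: "affine_vec (n + 1) (snd (config (mws_afobdd n) w j))"
proof (induction j)
  case 0
  then show ?case by (simp add: mws_afobdd_def affine_vec_def unit_vec_def)
next
  case (Suc j)
  then show ?case
    unfolding snd_config_mws_Suc by (intro affine_vec_mult_mat affine_mat_affine_completion)
qed

text \<open>Truth value of \<open>x\<^sub>i \<oplus> y\<^sub>i\<close>, where unread variables count as 0.\<close>

definition xor_read :: "nat \<Rightarrow> bool list \<Rightarrow> nat \<Rightarrow> nat \<Rightarrow> bool" where
  "xor_read n w j i \<longleftrightarrow> (i < j \<and> w ! i) \<noteq> (n + i < j \<and> w ! (n + i))"

text \<open>Step j reads a single variable and so toggles at most the one coordinate belonging to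
  it.\<close>

lemma xor_read_Suc:
  assumes "i < n"
  shows "xor_read n w (Suc j) i \<longleftrightarrow>
    xor_read n w j i \<noteq> (w ! j \<and> i = (if j < n then j else j - n))"
  using assms unfolding xor_read_def by (auto simp: less_Suc_eq)

text \<open>Every step before the last is a pure flip. The strict bound on j excludes the
  configuration after the last step, which also moves the selected coordinate.\<close>

lemma snd_config_mws_index:
  assumes "j < 2 * n" "i < n"
  shows "snd (config (mws_afobdd n) w j) $ i = of_bool (xor_read n w j i)"
  using assms(1)
proof (induction j)
  case 0
  then show ?case
    using assms(2) by (simp add: mws_afobdd_def xor_read_def)
next
  case (Suc j)
  have v: "affine_vec (n + 1) (snd (config (mws_afobdd n) w j))"
    by (rule affine_vec_config_mws)
  then have dim: "snd (config (mws_afobdd n) w j) \<in> carrier_vec (n + 1)"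
    by (simp add: affine_vec_def)
  have "snd (config (mws_afobdd n) w (Suc j)) $ i =
      (\<Sum>k<n + 1. flip_coeff (if j < n then j else j - n) (w ! j) i k
        * snd (config (mws_afobdd n) w j) $ k)"
    unfolding snd_config_mws_Suc affine_completion_mult_index [OF dim assms(2)]
    using Suc.prems by (simp add: mws_coeff_def del: sum.lessThan_Suc)
  also have "\<dots> = (if w ! j \<and> i = (if j < n then j else j - n)
      then 1 - of_bool (xor_read n w j i) else of_bool (xor_read n w j i))"
    unfolding sum_flip_coeff [OF v assms(2)] Suc.IH [OF Suc_lessD [OF Suc.prems]] ..
  also have "\<dots> = of_bool (xor_read n w (Suc j) i)"
    unfolding xor_read_Suc [OF assms(2)] by (simp add: of_bool_def)
  finally show ?case .
qed

lemma snd_config_mws_final: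
  fixes w :: "bool list"
  assumes "n \<ge> 1" "i < n"
  defines "s \<equiv> fst (config (mws_afobdd n) w (2 * n))"
  shows "snd (config (mws_afobdd n) w (2 * n)) $ i =
    of_bool (i = 0 \<and> selects n s \<and> xor_read n w (2 * n) (s mod next_prime n - 1))"
proof -
  define j where "j = 2 * n - 1"
  have j: "2 * n = Suc j" "\<not> j < n" "j < 2 * n"
    using assms(1) by (auto simp: j_def)
  define v where "v = snd (config (mws_afobdd n) w j)"
  have v: "affine_vec (n + 1) v"
    unfolding v_def by (rule affine_vec_config_mws)
  then have dim: "v \<in> carrier_vec (n + 1)"
    by (simp add: affine_vec_def)
  have s: "s = mws_delta n j (fst (config (mws_afobdd n) w j)) (w ! j)"
    unfolding s_def j(1) by (rule fst_config_mws_Suc)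
  define t where "t = s mod next_prime n - 1"
  have eq: "snd (config (mws_afobdd n) w (2 * n)) $ i =
      (\<Sum>k<n + 1. (if i = 0 \<and> selects n s then flip_coeff (j - n) (w ! j) t k else 0) * v $ k)"
    unfolding j(1) snd_config_mws_Suc v_def [symmetric]
      affine_completion_mult_index [OF dim assms(2)] mws_coeff_def s [symmetric] t_def Let_def
    by (simp add: j(1) del: sum.lessThan_Suc)
  show ?thesis
  proof (cases "i = 0 \<and> selects n s")
    case True
    then have t: "t < n"
      by (auto simp: selects_def t_def)
    \<comment> \<open>Row 0 now draws on coordinate t, so the invariant is applied at t instead of
      i.\<close>
    have "v $ t = of_bool (xor_read n w j t)"
      unfolding v_def by (rule snd_config_mws_index [OF j(3) t])
    then have "snd (config (mws_afobdd n) w (2 * n)) $ i = of_bool (xor_read n w (Suc j) t)"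
      unfolding eq using True sum_flip_coeff [OF v t] j(2) t
      by (auto simp: xor_read_Suc simp del: sum.lessThan_Suc)
    then show ?thesis
      using True by (simp add: j(1) t_def)
  next
    case False
    then show ?thesis
      unfolding eq by auto
  qed
qed

section \<open>The acceptance probability\<close>

lemma weighted_sum_eq:
  "weighted_sum n z = (\<Sum>i<n. Suc i * of_bool (z ! i)) mod next_prime n"
proof -
  have "(\<Sum>i=1..n. i * of_bool (z ! (i - 1))) = (\<Sum>i<n. Suc i * of_bool (z ! i))"
    using sum.atLeast1_atMost_eq [of "\<lambda>i. i * of_bool (z ! (i - 1))" n] by simp
  then show ?thesis
    by (simp add: weighted_sum_def)
qed

lemma accept_prob_mws:
  assumes "n \<ge> 1" "length w = 2 * n"
  shows "accept_prob (2 * n) (mws_afobdd n) w = of_bool (MWS n (take n w) (drop n w))"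
proof -
  define p where "p = next_prime n"
  define s where "s = fst (config (mws_afobdd n) w (2 * n))"
  define v where "v = snd (config (mws_afobdd n) w (2 * n))"
  define c where "c = MWS n (take n w) (drop n w)"
  have p: "p > 0"
    using next_prime_greater [of n] by (simp add: p_def)
  have "weighted_sum n (take n w) = (\<Sum>i<n. Suc i * of_bool (w ! i)) mod p"
    unfolding weighted_sum_eq p_def by simp
  moreover have "weighted_sum n (drop n w) = (\<Sum>i<n. Suc i * of_bool (w ! (n + i))) mod p"
    unfolding weighted_sum_eq p_def using assms(2) by simp
  ultimately have s: "s = weighted_sum n (take n w) + p * weighted_sum n (drop n w)"
    unfolding s_def fst_config_mws p_def by simp
  have less: "weighted_sum n z < p" for z
    using p by (simp add: weighted_sum_eq p_def)
  have smod: "s mod p = weighted_sum n (take n w)" and sdiv: "s div p = weighted_sum n (drop n w)"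
    using less p by (simp_all add: s)
  have "s < p\<^sup>2"
    unfolding s by (intro pair_encoding_less less)
  then have acc: "s \<in> acc_states (mws_afobdd n)"
    by (simp add: mws_afobdd_def p_def)
  have c: "selects n s \<and> xor_read n w (2 * n) (s mod p - 1) \<longleftrightarrow> c"
  proof (cases "selects n s")
    case True
    define i where "i = weighted_sum n (take n w)"
    have i: "i = weighted_sum n (drop n w)" "i \<in> {1..n}"
      using True unfolding selects_def p_def [symmetric] smod sdiv i_def by auto
    \<comment> \<open>After 2n steps both variables of each pair have been read, so the guards in
      \<open>xor_read\<close> hold.\<close>
    then have "xor_read n w (2 * n) (i - 1) \<longleftrightarrow> w ! (i - 1) \<noteq> w ! (n + (i - 1))"
      by (auto simp: xor_read_def)
    also have "\<dots> \<longleftrightarrow> take n w ! (i - 1) \<noteq> drop n w ! (i - 1)"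
    proof -
      have "i - 1 < n" "n \<le> length w"
        using i(2) assms by auto
      then show ?thesis
        by (simp only: nth_take nth_drop)
    qed
    finally show ?thesis
      using True i unfolding smod i_def [symmetric] c_def MWS_def Let_def by simp
  next
    case False
    then show ?thesis
      unfolding selects_def p_def [symmetric] smod sdiv c_def MWS_def Let_def by auto
  qed
  have v: "v $ i = of_bool (i = 0 \<and> c)" if "i < n" for i
    using snd_config_mws_final [OF assms(1) that, of w] c
    by (simp add: v_def s_def p_def)
  have "(\<Sum>i<n. v $ i) = (\<Sum>i<n. if i = 0 then of_bool c else 0)"
    and "(\<Sum>i<n. \<bar>v $ i\<bar>) = (\<Sum>i<n. if i = 0 then of_bool c else 0)"
    by (auto intro!: sum.cong simp: v)
  then have sums: "(\<Sum>i<n. v $ i) = of_bool c" "(\<Sum>i<n. \<bar>v $ i\<bar>) = of_bool c"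
    using assms(1) by simp_all
  have "(\<Sum>i<n + 1. v $ i) = 1"
    using affine_vec_config_mws unfolding v_def affine_vec_def by blast
  \<comment> \<open>The last coordinate is also 0 or 1, hence the norm is 1 and the acceptance
    probability is entry 0 itself.\<close>
  then have "v $ n = 1 - of_bool c"
    using sums by simp
  then have norm: "(\<Sum>i<n + 1. \<bar>v $ i\<bar>) = 1"
    using sums by simp
  have "accept_prob (2 * n) (mws_afobdd n) w = \<bar>v $ 0\<bar> / (\<Sum>i<n + 1. \<bar>v $ i\<bar>)"
    using acc unfolding accept_prob_def case_prod_beta Let_def s_def v_def
    by (simp add: mws_afobdd_def)
  also have "\<dots> = of_bool c"
    using norm v [of 0] assms(1) by simp
  finally show ?thesis
    by (simp add: c_def)
qed

theorem theorem4:
  fixes n :: nat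
  assumes "n \<ge> 1"
  shows "\<exists>M :: nat afobdd.
    is_afobdd (2 * n) M \<and>
    var_order M = id \<and>
    card (states M) = (next_prime n)\<^sup>2 \<and>
    num_affine M = n + 1 \<and>
    computes_exactly (2 * n) M (\<lambda>w. MWS n (take n w) (drop n w))"
proof (intro exI conjI)
  show "is_afobdd (2 * n) (mws_afobdd n)"
    using assms by (rule is_afobdd_mws)
  show "computes_exactly (2 * n) (mws_afobdd n) (\<lambda>w. MWS n (take n w) (drop n w))"
    using assms by (simp add: computes_exactly_def accept_prob_mws)
qed (simp_all add: mws_afobdd_def)

end
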